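(* Let $\lambda=(\lambda_n)$ be a frequency satisfying Bohr's condition $(BC)$. Then there is a constant $C=C(\lambda)>0$ such that for all $D=\sum a_n e^{-\lambda_n s}\in\mathcal{D}_\infty^{ext}(\lambda)$ and all $N\in\mathbf{N}$ with $N\ge 2$, $$\sup_{[Re>0]}\left|\sum_{n=1}^{N} a_n e^{-\lambda_n s}\right|\le C\lambda_N\|D\|_\infty.$$
   Context: A frequency is a strictly increasing sequence $\lambda=(\lambda_n)_{n\in\mathbf{N}}$ of non-negative real numbers tending to $+\infty$ ($\mathbf{N}=\{1,2,\dots\}$). A $\lambda$-Dirichlet series is a formal sum $D=\sum_{n\ge 1} a_n e^{-\lambda_n s}$ with complex coefficients $a_n$ and complex variable $s$. $[Re>\sigma]=\{s\in\mathbf{C}: \mathrm{Re}\,s>\sigma\}$. If $D$ converges at some point, it converges on some half-plane $[Re>\sigma]$ to a holomorphic function. $\mathcal{D}_\infty^{ext}(\lambda)$ is the space of all $\lambda$-Dirichlet series $D$ which converge at some point of $\mathbf{C}$ and whose limit function has a (unique) holomorphic and bounded extension $f$ to $[Re>0]$; $\|D\|_\infty:=\sup_{[Re>0]}|f(s)|$. Bohr's condition $(BC)$: there is $l=l(\lambda)>0$ such that for every $\delta>0$ there is $C>0$ such that for all $n\in\mathbf{N}$, $\lambda_{n+1}-\lambda_n\ge C e^{-(l+\delta)\lambda_n}$. *)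

theory Defs
  imports "HOL-Complex_Analysis.Complex_Analysis"
begin

text \<open>
  Sequences are indexed by the positive integers: a frequency \<open>lam\<close> and a coefficient
  sequence \<open>a\<close> are functions on \<open>nat\<close> whose value at 0 is never used.
\<close>

definition frequency :: "(nat \<Rightarrow> real) \<Rightarrow> bool" where
  "frequency lam \<longleftrightarrow>
     (\<forall>n\<ge>1. 0 \<le> lam n) \<and> strict_mono_on {1..} lam \<and> filterlim lam at_top sequentially"

definition bohr_condition :: "(nat \<Rightarrow> real) \<Rightarrow> bool" where
  "bohr_condition lam \<longleftrightarrow>
     (\<exists>l>0. \<forall>\<delta>>0. \<exists>C>0. \<forall>n\<ge>1. lam (n + 1) - lam n \<ge> C * exp (- (l + \<delta>) * lam n))"

definition right_half_plane :: "real \<Rightarrow> complex set" where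
  "right_half_plane \<sigma> = {s. Re s > \<sigma>}"

definition dirichlet_term :: "(nat \<Rightarrow> real) \<Rightarrow> (nat \<Rightarrow> complex) \<Rightarrow> complex \<Rightarrow> nat \<Rightarrow> complex" where
  "dirichlet_term lam a s n = a n * exp (- complex_of_real (lam n) * s)"

text \<open>The shift by \<open>Suc\<close> makes the series start at index 1; convergence need not be absolute.\<close>

definition dirichlet_converges :: "(nat \<Rightarrow> real) \<Rightarrow> (nat \<Rightarrow> complex) \<Rightarrow> complex \<Rightarrow> bool" where
  "dirichlet_converges lam a s \<longleftrightarrow> summable (\<lambda>n. dirichlet_term lam a s (Suc n))"

definition dirichlet_limit :: "(nat \<Rightarrow> real) \<Rightarrow> (nat \<Rightarrow> complex) \<Rightarrow> complex \<Rightarrow> complex" where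
  "dirichlet_limit lam a s = (\<Sum>n. dirichlet_term lam a s (Suc n))"

text \<open>
  \<open>f\<close> is a bounded holomorphic extension to \<open>Re s > 0\<close> of the limit function. The limit function
  lives on some half-plane of convergence \<open>Re s > \<sigma>\<close>; taking \<open>\<sigma> \<ge> 0\<close> loses nothing, because a
  half-plane of convergence may be shrunk.
\<close>

definition bounded_extension ::
    "(nat \<Rightarrow> real) \<Rightarrow> (nat \<Rightarrow> complex) \<Rightarrow> (complex \<Rightarrow> complex) \<Rightarrow> bool" where
  "bounded_extension lam a f \<longleftrightarrow>
     f holomorphic_on right_half_plane 0 \<and>
     bounded (f ` right_half_plane 0) \<and>
     (\<exists>\<sigma>\<ge>0. \<forall>s\<in>right_half_plane \<sigma>. dirichlet_converges lam a s \<and> f s = dirichlet_limit lam a s)"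

definition D_infty_ext :: "(nat \<Rightarrow> real) \<Rightarrow> (nat \<Rightarrow> complex) set" where
  "D_infty_ext lam =
     {a. (\<exists>s. dirichlet_converges lam a s) \<and> (\<exists>f. bounded_extension lam a f)}"

text \<open>The choice is harmless: any two extensions agree on \<open>Re s > 0\<close> (\<open>bounded_extension_unique\<close> below).\<close>

definition the_extension :: "(nat \<Rightarrow> real) \<Rightarrow> (nat \<Rightarrow> complex) \<Rightarrow> complex \<Rightarrow> complex" where
  "the_extension lam a = (SOME f. bounded_extension lam a f)"

definition D_norm :: "(nat \<Rightarrow> real) \<Rightarrow> (nat \<Rightarrow> complex) \<Rightarrow> real" where
  "D_norm lam a = (SUP s\<in>right_half_plane 0. norm (the_extension lam a s))"

lemma bounded_extension_unique:
  assumes f: "bounded_extension lam a f" and g: "bounded_extension lam a g"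
    and s: "s \<in> right_half_plane 0"
  shows "f s = g s"
proof -
  obtain \<sigma> \<tau> where st: "\<sigma> \<ge> 0" "\<tau> \<ge> 0"
    and fs: "\<And>z. z \<in> right_half_plane \<sigma> \<Longrightarrow> f z = dirichlet_limit lam a z"
    and gs: "\<And>z. z \<in> right_half_plane \<tau> \<Longrightarrow> g z = dirichlet_limit lam a z"
    using f g unfolding bounded_extension_def by blast
  define m where "m = max \<sigma> \<tau>"
  show ?thesis
  proof (rule analytic_continuation_open[of "right_half_plane m" "right_half_plane 0" f g])
    show "open (right_half_plane m)" "open (right_half_plane 0)"
      by (auto simp: right_half_plane_def open_halfspace_Re_gt)
    show "right_half_plane m \<noteq> {}"
      by (auto simp: right_half_plane_def intro!: exI[of _ "complex_of_real (m + 1)"])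
    show "connected (right_half_plane 0)"
      by (auto simp: right_half_plane_def intro!: convex_connected convex_halfspace_Re_gt)
    show "right_half_plane m \<subseteq> right_half_plane 0"
      using st by (auto simp: right_half_plane_def m_def)
    show "f holomorphic_on right_half_plane 0" "g holomorphic_on right_half_plane 0"
      using f g by (auto simp: bounded_extension_def)
    show "f z = g z" if "z \<in> right_half_plane m" for z
      using that fs[of z] gs[of z] by (auto simp: right_half_plane_def m_def)
  qed (use s in auto)
qed

text \<open>The suprema are taken in \<open>real\<close>, so they are meaningful only for bounded sets.\<close>

lemma bdd_above_partial_sum:
  assumes "frequency lam"
  shows "bdd_above ((\<lambda>s. norm (\<Sum>n=1..N. dirichlet_term lam a s n)) ` right_half_plane 0)"
proof (rule bdd_aboveI2)
  fix s assume s: "s \<in> right_half_plane 0"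
  have "norm (dirichlet_term lam a s n) \<le> norm (a n)" if "n \<in> {1..N}" for n
    using that s assms
    by (auto simp: dirichlet_term_def norm_mult right_half_plane_def frequency_def
        intro!: mult_left_le)
  then show "norm (\<Sum>n=1..N. dirichlet_term lam a s n) \<le> (\<Sum>n=1..N. norm (a n))"
    by (intro sum_norm_le) auto
qed

lemma bdd_above_extension:
  assumes "a \<in> D_infty_ext lam"
  shows "bdd_above ((\<lambda>s. norm (the_extension lam a s)) ` right_half_plane 0)"
proof -
  have "bounded_extension lam a (the_extension lam a)"
    using assms someI_ex[of "bounded_extension lam a"] by (auto simp: D_infty_ext_def the_extension_def)
  then show ?thesis
    by (auto simp: bounded_extension_def bounded_iff bdd_above_def)
qed

end

theory Submission
  imports Defs
begin

text \<open>
  Put \<open>a = \<lambda>\<^sub>N\<close> and choose \<open>b \<le> \<lambda>\<^bsub>N+1\<^esub>\<close> with \<open>b - a = min 1 (\<lambda>\<^bsub>N+1\<^esub> - \<lambda>\<^sub>N)\<close>. By Perron's formula the kernel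
  \<open>K(z) = (e\<^bsup>bz\<^esup> - e\<^bsup>az\<^esup>) / ((b - a) z\<^sup>2)\<close>, integrated against \<open>e\<^bsup>-lz\<^esup>\<close> over a vertical line \<open>Re z = c > 0\<close>, gives
  \<open>2\<pi>\<i>\<close> times the trapezoid function of \<open>l\<close> that is 1 for \<open>l \<le> a\<close> and 0 for \<open>l \<ge> b\<close>. Hence
  integrating \<open>f(s + z) K(z)\<close> over a line so far to the right that the series converges absolutely (such
  a line exists by Bohr's condition) yields \<open>2\<pi>\<i>\<close> times the \<open>N\<close>-th partial sum at \<open>s\<close>. Since \<open>f\<close> is bounded and \<open>K\<close>
  decays quadratically, the line may be moved to \<open>Re z = 1/b\<close>, where \<open>K\<close> has \<open>L\<^sup>1\<close> norm
  \<open>O(log (1 + 4 b / (b - a)))\<close>; Bohr's condition makes this \<open>O(\<lambda>\<^sub>N)\<close>.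
\<close>

section \<open>Integrals over vertical segments and Perron's formula\<close>

text \<open>Truncation at height \<open>T\<close> means that every statement about a full vertical
  line becomes a limit as \<open>T\<close> tends to infinity, so no improper integral
  occurs.\<close>

definition vertical_integral :: "(complex \<Rightarrow> complex) \<Rightarrow> real \<Rightarrow> real \<Rightarrow> complex" where
  "vertical_integral f c T = contour_integral (linepath (Complex c (- T)) (Complex c T)) f"

lemma vertical_integral_bound:
  assumes "T > 0"
    and cont: "continuous_on {z. Re z = c} f"
    and \<phi>: "(\<phi> has_integral I) {-T..T}"
    and le: "\<And>t. \<bar>t\<bar> \<le> T \<Longrightarrow> norm (f (Complex c t)) \<le> \<phi> t"
  shows "norm (vertical_integral f c T) \<le> I"
proof -
  have "continuous_on {-T..T} (\<lambda>t. f (Complex c t))"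
    by (rule continuous_on_compose2[OF cont]) (auto simp: Complex_eq intro!: continuous_intros)
  then have int: "(\<lambda>t. f (Complex c t)) integrable_on {-T..T}"
    by (rule integrable_continuous_interval)
  have "norm (vertical_integral f c T) = norm (integral {-T..T} (\<lambda>t. f (Complex c t)))"
    unfolding vertical_integral_def
    using assms(1) by (subst contour_integral_linepath_same_Re[of _ c _ "-T" T]) (auto simp: norm_mult)
  also have "\<dots> \<le> integral {-T..T} \<phi>"
    by (rule integral_norm_bound_integral) (use int \<phi> le in auto)
  also have "\<dots> = I"
    using \<phi> by (rule integral_unique)
  finally show ?thesis .
qed

lemma vertical_integral_add:
  assumes "continuous_on {z. Re z = c} f" "continuous_on {z. Re z = c} g"
  shows "vertical_integral (\<lambda>z. f z + g z) c T = vertical_integral f c T + vertical_integral g c T"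
proof -
  have "closed_segment (Complex c (-T)) (Complex c T) \<subseteq> {z. Re z = c}"
    by (auto simp: closed_segment_same_Re)
  then show ?thesis
    unfolding vertical_integral_def
    by (intro contour_integral_add contour_integrable_continuous_linepath)
       (use assms continuous_on_subset in blast)+
qed

lemma vertical_integral_sum:
  assumes "finite A" "\<And>n. n \<in> A \<Longrightarrow> continuous_on {z. Re z = c} (f n)"
  shows "vertical_integral (\<lambda>z. \<Sum>n\<in>A. f n z) c T = (\<Sum>n\<in>A. vertical_integral (f n) c T)"
proof -
  have "closed_segment (Complex c (-T)) (Complex c T) \<subseteq> {z. Re z = c}"
    by (auto simp: closed_segment_same_Re)
  then show ?thesis
    unfolding vertical_integral_def
    by (intro contour_integral_sum contour_integrable_continuous_linepath)
       (use assms continuous_on_subset in blast)+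
qed

lemma vertical_integral_cmult:
  assumes "continuous_on {z. Re z = c} f"
  shows "vertical_integral (\<lambda>z. k * f z) c T = k * vertical_integral f c T"
proof -
  have "closed_segment (Complex c (-T)) (Complex c T) \<subseteq> {z. Re z = c}"
    by (auto simp: closed_segment_same_Re)
  then show ?thesis
    unfolding vertical_integral_def
    by (intro contour_integral_lmul contour_integrable_continuous_linepath)
       (use assms continuous_on_subset in blast)+
qed

text \<open>The rectangle contributes its two vertical sides with opposite signs, so the difference
  consists of the two horizontal sides, each of length \<open>v - u\<close>. The rectangle integral
  is left unevaluated because the lemma serves both with a pole inside and with none.\<close>

lemma vertical_integral_shift:
  assumes uv: "u \<le> v" and T: "0 < T"
    and cont: "continuous_on (path_image (rectpath (Complex u (-T)) (Complex v T))) f"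
    and le: "\<And>x y. u \<le> x \<Longrightarrow> x \<le> v \<Longrightarrow> \<bar>y\<bar> = T \<Longrightarrow> norm (f (Complex x y)) \<le> B"
  shows "norm (vertical_integral f v T - vertical_integral f u T
            - contour_integral (rectpath (Complex u (-T)) (Complex v T)) f) \<le> 2 * B * (v - u)"
proof -
  let ?a1 = "Complex u (-T)" and ?a2 = "Complex v (-T)" and ?a3 = "Complex v T" and ?a4 = "Complex u T"
  have sub: "closed_segment ?a1 ?a2 \<subseteq> path_image (rectpath ?a1 ?a3)"
    "closed_segment ?a2 ?a3 \<subseteq> path_image (rectpath ?a1 ?a3)"
    "closed_segment ?a3 ?a4 \<subseteq> path_image (rectpath ?a1 ?a3)"
    "closed_segment ?a4 ?a1 \<subseteq> path_image (rectpath ?a1 ?a3)"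
    by (auto simp: rectpath_def Let_def path_image_join)
  have int: "f contour_integrable_on linepath ?a1 ?a2" "f contour_integrable_on linepath ?a2 ?a3"
    "f contour_integrable_on linepath ?a3 ?a4" "f contour_integrable_on linepath ?a4 ?a1"
    by (intro contour_integrable_continuous_linepath continuous_on_subset[OF cont] sub)+
  have "contour_integral (rectpath ?a1 ?a3) f
      = contour_integral (linepath ?a1 ?a2) f + vertical_integral f v T
        + contour_integral (linepath ?a3 ?a4) f + contour_integral (linepath ?a4 ?a1) f"
    using int by (simp add: rectpath_def Let_def vertical_integral_def)
  also have "contour_integral (linepath ?a4 ?a1) f = - vertical_integral f u T"
    unfolding vertical_integral_def
    using contour_integral_reverse_linepath[of ?a4 ?a1 f]
      continuous_on_subset[OF cont sub(4)] by simp
  finally have eq: "vertical_integral f v T - vertical_integral f u T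
            - contour_integral (rectpath ?a1 ?a3) f
      = - contour_integral (linepath ?a1 ?a2) f - contour_integral (linepath ?a3 ?a4) f"
    by simp
  have "norm (f (Complex u T)) \<le> B"
    using le[of u T] uv T by simp
  then have B0: "0 \<le> B"
    using norm_ge_zero order_trans by blast
  have seg: "closed_segment ?a1 ?a2 = {z. Im z = -T \<and> Re z \<in> {u..v}}"
    "closed_segment ?a3 ?a4 = {z. Im z = T \<and> Re z \<in> {u..v}}"
    using uv by (auto simp: closed_segment_same_Im closed_segment_eq_real_ivl)
  have "norm (contour_integral (linepath ?a1 ?a2) f) \<le> B * norm (?a2 - ?a1)"
    by (rule contour_integral_bound_linepath[OF int(1) B0])
       (use le T in \<open>auto simp: seg\<close>, metis abs_minus abs_of_pos complex_surj)
  moreover have "norm (contour_integral (linepath ?a3 ?a4) f) \<le> B * norm (?a4 - ?a3)"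
    by (rule contour_integral_bound_linepath[OF int(3) B0])
       (use le T in \<open>auto simp: seg\<close>, metis abs_of_pos complex_surj)
  moreover have "norm (?a2 - ?a1) = v - u" "norm (?a4 - ?a3) = v - u"
    using uv by (auto simp: complex_diff cmod_def)
  ultimately have "norm (contour_integral (linepath ?a1 ?a2) f) + norm (contour_integral (linepath ?a3 ?a4) f)
      \<le> 2 * B * (v - u)"
    by simp
  then show ?thesis
    unfolding eq
    using norm_triangle_ineq4[of "- contour_integral (linepath ?a1 ?a2) f" "contour_integral (linepath ?a3 ?a4) f"]
    by simp
qed

text \<open>The rectangle surrounds the double pole at 0 once, and the residue there is the
  derivative of \<open>exp (y * z)\<close> at 0, which is \<open>y\<close>.\<close>

lemma contour_integral_rectpath_exp_over_square:
  assumes "u < 0" "0 < v" "0 < T"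
  shows "contour_integral (rectpath (Complex u (-T)) (Complex v T)) (\<lambda>z. exp (of_real y * z) / z\<^sup>2)
    = 2 * pi * \<i> * y"
proof -
  let ?g = "rectpath (Complex u (-T)) (Complex v T)"
  have hd: "((\<lambda>z::complex. exp (of_real y * z)) has_field_derivative of_real y) (at 0)"
    by (auto intro!: derivative_eq_intros)
  have "residue (\<lambda>z::complex. exp (of_real y * z) / z ^ Suc 1) 0 = y"
    by (subst residue_holomorphic_over_power'[of UNIV])
       (use DERIV_imp_deriv[OF hd] in \<open>auto intro!: holomorphic_intros\<close>)
  then have res: "residue (\<lambda>z::complex. exp (of_real y * z) / z\<^sup>2) 0 = y"
    by (simp add: power2_eq_square)
  have "winding_number ?g 0 = 1"
    by (rule winding_number_rectpath) (use assms in \<open>auto simp: in_box_complex_iff\<close>)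
  moreover have "contour_integral ?g (\<lambda>z. exp (of_real y * z) / z\<^sup>2)
     = 2 * pi * \<i> * (\<Sum>p\<in>{0}. winding_number ?g p * residue (\<lambda>z. exp (of_real y * z) / z\<^sup>2) p)"
    by (rule Residue_theorem[of UNIV])
       (use assms in \<open>auto simp: path_image_rectpath intro!: holomorphic_intros\<close>)
  ultimately show ?thesis
    using res by simp
qed

lemma norm_exp_over_square_le:
  assumes "0 < T" "T \<le> norm z" "y * Re z \<le> r"
  shows "norm (exp (of_real y * z) / z\<^sup>2) \<le> exp r / T\<^sup>2"
  using assms by (auto simp: norm_divide norm_power intro!: frac_le power_mono)

text \<open>For \<open>y \<ge> 0\<close> the contour is closed to the left, across the pole at 0;
  for \<open>y < 0\<close> it is closed to the right, where there is none. On each rectangle used,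
  \<open>E\<close> bounds the exponential, and the other three sides contribute
  \<open>O(E / T)\<close>.\<close>

lemma perron_formula:
  fixes c y :: real
  assumes c: "0 < c"
  shows "((\<lambda>T. vertical_integral (\<lambda>z. exp (of_real y * z) / z\<^sup>2) c T) \<longlongrightarrow> 2 * pi * \<i> * max y 0) at_top"
proof -
  let ?f = "\<lambda>z::complex. exp (of_real y * z) / z\<^sup>2"
  define E where "E = exp (\<bar>y\<bar> * c)"
  have E1: "E \<ge> 1" using c by (simp add: E_def)
  \<comment> \<open>The closing side lies at distance \<open>T\<close> from the imaginary axis, on
    the side where the exponential has norm at most 1: length \<open>2 * T\<close> times
    \<open>E / T\<^sup>2\<close>.\<close>
  have far: "norm (vertical_integral ?f x T) \<le> 2 * E / T"
    if T: "0 < T" and x: "\<bar>x\<bar> = T" and yx: "y * x \<le> 0" for x T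
  proof (rule vertical_integral_bound[where \<phi> = "\<lambda>_. E / T\<^sup>2"])
    show "continuous_on {z. Re z = x} ?f"
      using T x by (auto intro!: continuous_intros)
    show "((\<lambda>_. E / T\<^sup>2) has_integral 2 * E / T) {-T..T}"
      using T has_integral_const_real[of "E / T\<^sup>2" "-T" T]
      by (simp add: field_simps power2_eq_square)
    show "norm (?f (Complex x t)) \<le> E / T\<^sup>2" for t
    proof -
      have "0 \<le> \<bar>y\<bar> * c"
        using c by simp
      then show ?thesis
        unfolding E_def
        using T x yx abs_Re_le_cmod[of "Complex x t"] by (intro norm_exp_over_square_le) auto
    qed
  qed (use T in auto)
  have bound: "norm (vertical_integral ?f c T - 2 * pi * \<i> * max y 0) \<le> 6 * E / T" if T: "T > c" for T
  proof (cases "y \<ge> 0")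
    case True
    have "norm (vertical_integral ?f c T - vertical_integral ?f (-T) T
            - contour_integral (rectpath (Complex (-T) (-T)) (Complex c T)) ?f)
          \<le> 2 * (E / T\<^sup>2) * (c - (- T))"
    proof (rule vertical_integral_shift)
      show "continuous_on (path_image (rectpath (Complex (- T) (- T)) (Complex c T))) ?f"
        using T c by (subst path_image_rectpath) (auto intro!: continuous_intros)
      show "norm (?f (Complex x t)) \<le> E / T\<^sup>2" if "-T \<le> x" "x \<le> c" "\<bar>t\<bar> = T" for x t
        unfolding E_def
        by (rule norm_exp_over_square_le)
           (use that T c True abs_Im_le_cmod[of "Complex x t"] in \<open>auto intro!: mult_left_mono\<close>)
    qed (use T c in auto)
    \<comment> \<open>The rectangle widens with \<open>T\<close>, but only linearly, so the
      quadratic decay still wins.\<close>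
    also have "\<dots> \<le> 2 * (E / T\<^sup>2) * (2 * T)"
      using T c E1 by (intro mult_left_mono) auto
    also have "\<dots> = 4 * E / T"
      using T c by (simp add: field_simps power2_eq_square)
    also have "contour_integral (rectpath (Complex (-T) (-T)) (Complex c T)) ?f = 2 * pi * \<i> * y"
      by (rule contour_integral_rectpath_exp_over_square) (use T c in auto)
    finally have 1: "norm (vertical_integral ?f c T - vertical_integral ?f (-T) T - 2 * pi * \<i> * y) \<le> 4 * E / T" .
    have 2: "norm (vertical_integral ?f (-T) T) \<le> 2 * E / T"
      by (rule far) (use T c True in \<open>auto intro!: mult_nonneg_nonneg\<close>)
    have "norm (vertical_integral ?f c T - 2 * pi * \<i> * y) \<le> 4 * E / T + 2 * E / T"
      using norm_triangle_mono[OF 1 2] by (simp add: algebra_simps)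
    then show ?thesis using True by (simp add: max_def)
  next
    case False
    have "norm (vertical_integral ?f T T - vertical_integral ?f c T
            - contour_integral (rectpath (Complex c (-T)) (Complex T T)) ?f)
          \<le> 2 * (E / T\<^sup>2) * (T - c)"
    proof (rule vertical_integral_shift)
      show "continuous_on (path_image (rectpath (Complex c (- T)) (Complex T T))) ?f"
        using T c by (subst path_image_rectpath) (auto intro!: continuous_intros)
      show "norm (?f (Complex x t)) \<le> E / T\<^sup>2" if "c \<le> x" "x \<le> T" "\<bar>t\<bar> = T" for x t
      proof -
        have "y * x \<le> 0"
          using that c False by (intro mult_nonpos_nonneg) auto
        also have "0 \<le> \<bar>y\<bar> * c"
          using c by simp
        finally show ?thesis
          unfolding E_def
          by (intro norm_exp_over_square_le)
             (use that T c abs_Im_le_cmod[of "Complex x t"] in auto)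
      qed
    qed (use T c in auto)
    also have "\<dots> \<le> 2 * (E / T\<^sup>2) * (2 * T)"
      using T c E1 by (intro mult_left_mono) auto
    also have "\<dots> = 4 * E / T"
      using T c by (simp add: field_simps power2_eq_square)
    \<comment> \<open>This rectangle stays in \<open>Re z > 0\<close>, away from the pole.\<close>
    also have "contour_integral (rectpath (Complex c (-T)) (Complex T T)) ?f = 0"
      by (intro contour_integral_unique Cauchy_theorem_convex_simple[of _ "{z. Re z > 0}"])
         (use T c in \<open>auto intro!: holomorphic_intros convex_halfspace_Re_gt simp: path_image_rectpath\<close>)
    finally have 1: "norm (vertical_integral ?f T T - vertical_integral ?f c T) \<le> 4 * E / T" by simp
    have 2: "norm (vertical_integral ?f T T) \<le> 2 * E / T"
      by (rule far) (use T c False in \<open>auto intro: mult_nonpos_nonneg\<close>)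
    have "norm (vertical_integral ?f c T) \<le> 4 * E / T + 2 * E / T"
      using 1 2 norm_triangle_ineq4[of "vertical_integral ?f T T" "vertical_integral ?f T T - vertical_integral ?f c T"]
      by simp
    then show ?thesis using False by (simp add: max_def)
  qed
  have "((\<lambda>T. 6 * E / T) \<longlongrightarrow> 0) at_top"
    by (intro tendsto_divide_0[OF tendsto_const] filterlim_at_top_imp_at_infinity filterlim_ident)
  then have "((\<lambda>T. vertical_integral ?f c T - 2 * pi * \<i> * max y 0) \<longlongrightarrow> 0) at_top"
    by (rule Lim_null_comparison[rotated])
       (use bound in \<open>auto simp: eventually_at_top_linorder intro!: exI[of _ "c + 1"]\<close>)
  then show ?thesis
    by (rule LIM_zero_cancel)
qed

section \<open>The smoothed Perron kernel\<close>

text \<open>The difference quotient in \<open>y\<close>, between \<open>a\<close> and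
  \<open>b\<close>, of the kernel \<open>exp (y * z) / z\<^sup>2\<close> of first-order Riesz
  means.\<close>

definition riesz_kernel :: "real \<Rightarrow> real \<Rightarrow> complex \<Rightarrow> complex" where
  "riesz_kernel a b z = (exp (of_real b * z) - exp (of_real a * z)) / (of_real (b - a) * z\<^sup>2)"

lemma riesz_kernel_holomorphic: "riesz_kernel a b holomorphic_on {z. Re z > 0}"
proof (cases "a = b")
  case False
  then show ?thesis
    unfolding riesz_kernel_def by (intro holomorphic_intros) auto
qed (auto simp: riesz_kernel_def[abs_def])

text \<open>The factor \<open>exp (- l * z)\<close> shifts both exponents by \<open>l\<close>, so
  \<open>perron_formula\<close> applies with \<open>y = b - l\<close> and \<open>y = a - l\<close>.
  The limit is the trapezoid in \<open>l\<close>: 1 up to \<open>a\<close>, linear on the ramp, 0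
  from \<open>b\<close> on.\<close>

lemma riesz_kernel_perron:
  assumes c: "0 < c" and ab: "a < b"
  shows "((\<lambda>T. vertical_integral (\<lambda>z. exp (- of_real l * z) * riesz_kernel a b z) c T)
           \<longlongrightarrow> 2 * pi * \<i> * complex_of_real ((max (b - l) 0 - max (a - l) 0) / (b - a))) at_top"
proof -
  let ?f = "\<lambda>y z::complex. exp (of_real y * z) / z\<^sup>2"
  let ?k = "1 / complex_of_real (b - a)"
  have cont: "continuous_on {z. Re z = c} (?f y)" for y
    using c by (auto intro!: continuous_intros)
  have eq: "exp (- of_real l * z) * riesz_kernel a b z = ?k * ?f (b - l) z + (- ?k) * ?f (a - l) z" for z
    using exp_add[of "- of_real l * z" "of_real b * z"] exp_add[of "- of_real l * z" "of_real a * z"]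
    by (simp add: riesz_kernel_def algebra_simps diff_divide_distrib)
  have "vertical_integral (\<lambda>z. exp (- of_real l * z) * riesz_kernel a b z) c T
      = ?k * vertical_integral (?f (b - l)) c T + (- ?k) * vertical_integral (?f (a - l)) c T" for T
    unfolding eq
    by (subst vertical_integral_add) (intro continuous_intros cont vertical_integral_cmult arg_cong2[of _ _ _ _ "(+)"])+
  moreover have "((\<lambda>T. ?k * vertical_integral (?f (b - l)) c T + (- ?k) * vertical_integral (?f (a - l)) c T)
    \<longlongrightarrow> ?k * (2 * pi * \<i> * max (b - l) 0) + (- ?k) * (2 * pi * \<i> * max (a - l) 0)) at_top"
    by (intro tendsto_intros perron_formula c)
  moreover have "?k * (2 * pi * \<i> * max (b - l) 0) + (- ?k) * (2 * pi * \<i> * max (a - l) 0)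
     = 2 * pi * \<i> * complex_of_real ((max (b - l) 0 - max (a - l) 0) / (b - a))"
    by (simp add: algebra_simps diff_divide_distrib)
  ultimately show ?thesis by (simp only:)
qed

text \<open>The triangle inequality gives the decay at large height; its cost is the factor
  \<open>1 / (b - a)\<close>.\<close>

lemma norm_riesz_kernel_le_inverse_square:
  assumes "0 \<le> a" "a < b" "0 < Re z"
  shows "norm (riesz_kernel a b z) \<le> 2 * exp (b * Re z) / ((b - a) * (norm z)\<^sup>2)"
proof -
  have "norm (exp (of_real b * z) - exp (of_real a * z)) \<le> exp (b * Re z) + exp (a * Re z)"
    using norm_triangle_ineq4[of "exp (of_real b * z)" "exp (of_real a * z)"] by simp
  also have "\<dots> \<le> 2 * exp (b * Re z)"
    using assms by simp
  finally show ?thesis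
    using assms by (auto simp: riesz_kernel_def norm_divide norm_mult norm_power simp flip: of_real_diff intro!: divide_right_mono)
qed

text \<open>The mean value inequality cancels \<open>b - a\<close> and one power of
  \<open>z\<close>, so this bound is the better one at small height. It is applied on a half-plane,
  convex and containing both exponents, on which the exponential has norm at most
  \<open>exp (b * Re z)\<close>.\<close>

lemma norm_riesz_kernel_le_inverse:
  assumes "0 \<le> a" "a < b" "0 < Re z"
  shows "norm (riesz_kernel a b z) \<le> exp (b * Re z) / norm z"
proof -
  have "norm (exp (of_real b * z) - exp (of_real a * z)) \<le> exp (b * Re z) * norm (of_real b * z - of_real a * z)"
    by (rule field_differentiable_bound[where S = "{w. Re w \<le> b * Re z}" and f' = exp])
       (use assms in \<open>auto intro!: derivative_eq_intros convex_halfspace_Re_le\<close>)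
  also have "norm (of_real b * z - of_real a * z) = (b - a) * norm z"
    using assms by (simp add: norm_mult flip: left_diff_distrib of_real_diff)
  finally have "norm (exp (of_real b * z) - exp (of_real a * z)) / ((b - a) * (norm z)\<^sup>2)
      \<le> exp (b * Re z) * ((b - a) * norm z) / ((b - a) * (norm z)\<^sup>2)"
    using assms by (intro divide_right_mono) auto
  moreover have "norm (exp (of_real b * z) - exp (of_real a * z)) / ((b - a) * (norm z)\<^sup>2) = norm (riesz_kernel a b z)"
    using assms by (simp add: riesz_kernel_def norm_divide norm_mult norm_power flip: of_real_diff)
  moreover have "exp (b * Re z) * ((b - a) * norm z) / ((b - a) * (norm z)\<^sup>2) = exp (b * Re z) / norm z"
    using assms by (auto simp: power2_eq_square)
  ultimately show ?thesis by simp
qed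

text \<open>
  The two preceding bounds are combined through \<open>min p q \<le> 2 p q / (p + q)\<close>, so that a single
  rational majorant with an elementary antiderivative covers the whole line.
\<close>

lemma norm_riesz_kernel_le:
  assumes "0 \<le> a" "a < b" "0 < c" and u_def: "u = (c + \<bar>t\<bar>) / 2"
  shows "norm (riesz_kernel a b (Complex c t)) \<le> exp (b * c) * (4 / (u * ((b - a) * u + 2)))"
proof -
  define x where "x = norm (Complex c t)"
  define d where "d = b - a"
  define n where "n = norm (riesz_kernel a b (Complex c t))"
  have d: "d > 0" using assms by (simp add: d_def)
  \<comment> \<open>\<open>u\<close> averages the real part and the absolute value of the imaginary
    part; replacing the norm by \<open>u\<close> makes the majorant rational in the absolute value
    of \<open>t\<close>.\<close>
  have u: "0 < u" "u \<le> x"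
    using assms abs_Re_le_cmod[of "Complex c t"] abs_Im_le_cmod[of "Complex c t"]
    unfolding u_def x_def by auto
  have 1: "n \<le> 2 * exp (b * c) / (d * x\<^sup>2)" and 2: "n \<le> exp (b * c) / x"
    using norm_riesz_kernel_le_inverse_square[of a b "Complex c t"]
      norm_riesz_kernel_le_inverse[of a b "Complex c t"] assms
    by (auto simp: n_def d_def x_def)
  have "n * (d * x\<^sup>2) \<le> 2 * exp (b * c)" "n * x \<le> exp (b * c)"
    using 1 2 d u by (auto simp: pos_le_divide_eq)
  \<comment> \<open>The first bound plus twice the second.\<close>
  then have "n * (x * (d * x + 2)) \<le> 4 * exp (b * c)"
    by (simp add: algebra_simps power2_eq_square)
  then have "n \<le> 4 * exp (b * c) / (x * (d * x + 2))"
    using d u by (subst pos_le_divide_eq) (auto intro!: mult_pos_pos add_pos_pos)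
  also have "\<dots> \<le> 4 * exp (b * c) / (u * (d * u + 2))"
    using d u by (intro divide_left_mono mult_mono mult_pos_pos add_mono) (auto intro!: add_pos_pos)
  finally show ?thesis by (simp add: n_def d_def mult.commute)
qed

text \<open>With \<open>u = (c + t) / 2\<close>, partial fractions give
  \<open>4 / (u * (d * u + 2)) = 2 * (1 / u - d / (d * u + 2))\<close>, hence the logarithms in
  \<open>F\<close>. The integrand is even, so the integral over \<open>{0..T}\<close> is
  doubled.\<close>

lemma has_integral_kernel_majorant:
  fixes c d T :: real
  assumes "0 < c" "0 < d" "0 < T"
  defines "F \<equiv> \<lambda>t. 4 * (ln ((c + t) / 2) - ln (d * ((c + t) / 2) + 2))"
  shows "((\<lambda>t. 4 / ((c + \<bar>t\<bar>) / 2 * (d * ((c + \<bar>t\<bar>) / 2) + 2))) has_integral 2 * (F T - F 0)) {-T..T}"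
proof -
  let ?g = "\<lambda>t. 4 / ((c + \<bar>t\<bar>) / 2 * (d * ((c + \<bar>t\<bar>) / 2) + 2))"
  have pos: "d * ((c + t) / 2) + 2 > 0" if "t \<ge> 0" for t
    using assms that by (intro add_nonneg_pos) auto
  have right: "(?g has_integral (F T - F 0)) {0..T}"
  proof (rule fundamental_theorem_of_calculus)
    fix t assume t: "t \<in> {0..T}"
    define u where "u = (c + t) / 2"
    have u: "u > 0" "d * u + 2 > 0"
      using t assms pos[of t] by (auto simp: u_def)
    have "(F has_real_derivative 4 * ((1 / 2) / u - d * (1 / 2) / (d * u + 2))) (at t within {0..T})"
      unfolding F_def using u unfolding u_def
      by (auto intro!: derivative_eq_intros simp: algebra_simps)
    also have "4 * ((1 / 2) / u - d * (1 / 2) / (d * u + 2)) = 4 / (u * (d * u + 2))"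
      using u by (simp add: divide_simps)
    also have "\<dots> = ?g t"
      using t by (simp add: u_def)
    finally show "(F has_vector_derivative ?g t) (at t within {0..T})"
      by (simp add: has_real_derivative_iff_has_vector_derivative)
  qed (use assms in auto)
  have left: "(?g has_integral (F T - F 0)) {-T..0}"
    using right has_integral_reflect_real[of ?g "F T - F 0" T 0] by simp
  have "(?g has_integral ((F T - F 0) + (F T - F 0))) {-T..T}"
    using assms(3) by (intro has_integral_combine[OF _ _ left right]) linarith+
  then show ?thesis by (simp only: mult_2)
qed

text \<open>The rational majorant is integrated exactly. The resulting bound is independent of
  \<open>T\<close>, which lets it survive the limit in \<open>T\<close>.\<close>

lemma vertical_integral_riesz_kernel_bound:
  assumes ab: "0 \<le> a" "a < b" and c: "0 < c" and T: "0 < T"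
    and cont: "continuous_on {z. Re z = c} f"
    and M: "\<And>z. Re z = c \<Longrightarrow> norm (f z) \<le> M"
  shows "norm (vertical_integral (\<lambda>z. f z * riesz_kernel a b z) c T)
    \<le> 8 * M * exp (b * c) * ln (1 + 4 / ((b - a) * c))"
proof -
  define d where "d = b - a"
  have d: "d > 0" using ab by (simp add: d_def)
  define F where "F = (\<lambda>t. 4 * (ln ((c + t) / 2) - ln (d * ((c + t) / 2) + 2)))"
  let ?g = "\<lambda>t. 4 / ((c + \<bar>t\<bar>) / 2 * (d * ((c + \<bar>t\<bar>) / 2) + 2))"
  have M0: "0 \<le> M"
    using M[of "of_real c"] norm_ge_zero[of "f (of_real c)"] by (simp del: norm_ge_zero)
  have "norm (vertical_integral (\<lambda>z. f z * riesz_kernel a b z) c T)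
     \<le> M * exp (b * c) * (2 * (F T - F 0))"
  proof (rule vertical_integral_bound[OF T])
    have "continuous_on {z. Re z = c} (riesz_kernel a b)"
      by (rule continuous_on_subset[OF holomorphic_on_imp_continuous_on[OF riesz_kernel_holomorphic]])
         (use c in auto)
    then show "continuous_on {z. Re z = c} (\<lambda>z. f z * riesz_kernel a b z)"
      using cont by (intro continuous_intros)
    show "((\<lambda>t. M * exp (b * c) * ?g t) has_integral M * exp (b * c) * (2 * (F T - F 0))) {-T..T}"
      unfolding F_def by (intro has_integral_mult_right has_integral_kernel_majorant c d T)
    show "norm (f (Complex c t) * riesz_kernel a b (Complex c t)) \<le> M * exp (b * c) * ?g t" for t
      using mult_mono[OF M[of "Complex c t"] norm_riesz_kernel_le[OF ab c refl, of t]] M0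
      by (simp add: norm_mult d_def)
  qed
  also have "\<dots> \<le> M * exp (b * c) * (2 * (4 * ln (1 + 4 / (d * c))))"
  proof (intro mult_left_mono)
    define u v where "u = (c + T) / 2" and "v = c / 2"
    have uv: "0 < u" "0 < v" "0 < d * u" "0 < d * v"
      using c T d by (auto simp: u_def v_def)
    \<comment> \<open>Dropping the 2 bounds the upper endpoint by \<open>- ln d\<close>, whatever
      \<open>T\<close> is.\<close>
    have "ln u - ln (d * u + 2) \<le> ln u - ln (d * u)"
      using uv by simp
    also have "\<dots> = - ln d"
      using uv d by (simp add: ln_mult)
    finally have "(ln u - ln (d * u + 2)) - (ln v - ln (d * v + 2)) \<le> ln (d * v + 2) - ln (d * v)"
      using uv d by (simp add: ln_mult)
    also have "\<dots> = ln ((d * v + 2) / (d * v))"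
      using uv by (subst ln_div) auto
    also have "(d * v + 2) / (d * v) = 1 + 4 / (d * c)"
      using uv c d by (simp add: v_def field_simps)
    finally show "F T - F 0 \<le> 4 * ln (1 + 4 / (d * c))"
      unfolding F_def u_def v_def by simp
  qed (use M0 in auto)
  finally show ?thesis by (simp add: d_def mult_ac)
qed

section \<open>Dirichlet series under Bohr's condition\<close>

text \<open>Bohr's condition with \<open>\<delta> = 1\<close> bounds each gap below by
  \<open>C * exp (- L * lam n)\<close>, where \<open>L = l + 1\<close>. Since
  \<open>exp x \<ge> 1 + x\<close>, each step then raises \<open>exp (L * lam n)\<close> by at least
  \<open>L * C\<close>.\<close>

lemma bohr_condition_exp_growth:
  assumes "frequency lam" "bohr_condition lam"
  obtains L \<kappa> where "L > 0" "\<kappa> > 0" "\<And>n. exp (L * lam (Suc n)) \<ge> \<kappa> * real n"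
proof -
  obtain l where l: "l > 0" "\<forall>\<delta>>0. \<exists>C>0. \<forall>n\<ge>1. lam (n + 1) - lam n \<ge> C * exp (- (l + \<delta>) * lam n)"
    using assms(2) unfolding bohr_condition_def by blast
  then obtain C where C: "C > 0" "\<And>n. n \<ge> 1 \<Longrightarrow> lam (n + 1) - lam n \<ge> C * exp (- (l + 1) * lam n)"
    by (meson zero_less_one)
  define L where "L = l + 1"
  have L: "L > 0" using l by (simp add: L_def)
  have "exp (L * lam (Suc n)) \<ge> (L * C) * real n" for n
  proof (induction n)
    case (Suc n)
    define e where "e = exp (L * lam (Suc n))"
    have gap: "C / e \<le> lam (Suc (Suc n)) - lam (Suc n)"
      using C(2)[of "Suc n"] unfolding e_def L_def minus_mult_left[symmetric] exp_minus divide_inverse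
      by simp
    have "(L * C) * real (Suc n) \<le> e + L * C"
      using Suc by (simp add: e_def algebra_simps)
    also have "\<dots> = e * (1 + L * (C / e))"
      by (simp add: e_def field_simps)
    also have "\<dots> \<le> e * (1 + L * (lam (Suc (Suc n)) - lam (Suc n)))"
      using gap L by (intro mult_left_mono add_left_mono) (auto simp: e_def)
    also have "\<dots> \<le> e * exp (L * (lam (Suc (Suc n)) - lam (Suc n)))"
      by (intro mult_left_mono exp_ge_add_one_self) (auto simp: e_def)
    also have "\<dots> = exp (L * lam (Suc (Suc n)))"
      by (simp add: e_def algebra_simps flip: exp_add)
    finally show ?case .
  qed auto
  then show ?thesis
    using that[of L "L * C"] L C by auto
qed

lemma norm_dirichlet_term: "norm (dirichlet_term lam a s n) = norm (a n) * exp (- lam n * Re s)"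
  by (simp add: dirichlet_term_def norm_mult)

text \<open>Convergence at \<open>s0\<close> bounds the terms there. Moving right by
  \<open>2 * L\<close> multiplies the term of index \<open>Suc n\<close> by the inverse square of
  \<open>exp (L * lam (Suc n))\<close>, which is \<open>O(1 / n\<^sup>2)\<close> by the growth
  estimate.\<close>

lemma absolute_convergence_far:
  assumes freq: "frequency lam" and bohr: "bohr_condition lam"
    and conv: "dirichlet_converges lam a s0"
  obtains \<tau> where "\<And>x. x \<ge> \<tau> \<Longrightarrow> summable (\<lambda>n. norm (a (Suc n)) * exp (- lam (Suc n) * x))"
proof -
  obtain L \<kappa> where L: "L > 0" "\<kappa> > 0" "\<And>n. exp (L * lam (Suc n)) \<ge> \<kappa> * real n"
    using bohr_condition_exp_growth[OF freq bohr] by blast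
  have "Bseq (\<lambda>n. dirichlet_term lam a s0 (Suc n))"
    using conv unfolding dirichlet_converges_def
    by (intro convergent_imp_Bseq) (auto dest: summable_LIMSEQ_zero simp: convergent_def)
  then obtain B where B: "B > 0" "\<And>n. norm (dirichlet_term lam a s0 (Suc n)) \<le> B"
    by (auto simp: Bseq_def)
  have "summable (\<lambda>n. norm (a (Suc n)) * exp (- lam (Suc n) * x))" if x: "x \<ge> Re s0 + 2 * L" for x
  proof (rule summable_comparison_test_ev)
    show "summable (\<lambda>n. B / \<kappa>\<^sup>2 * inverse (real n ^ 2))"
      by (intro summable_mult inverse_power_summable) auto
    have "norm (a (Suc n)) * exp (- lam (Suc n) * x) \<le> B / \<kappa>\<^sup>2 * inverse (real n ^ 2)" if n: "n \<ge> 1" for n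
    proof -
      have lam0: "lam (Suc n) \<ge> 0" using freq by (simp add: frequency_def)
      have "norm (a (Suc n)) * exp (- lam (Suc n) * x)
          \<le> norm (a (Suc n)) * exp (- lam (Suc n) * (Re s0 + 2 * L))"
        using x lam0 by (intro mult_left_mono) (auto intro!: mult_left_mono)
      also have "- lam (Suc n) * (Re s0 + 2 * L) = - lam (Suc n) * Re s0 - 2 * (L * lam (Suc n))"
        by (simp add: algebra_simps)
      also have "norm (a (Suc n)) * exp (- lam (Suc n) * Re s0 - 2 * (L * lam (Suc n)))
          = norm (dirichlet_term lam a s0 (Suc n)) / (exp (L * lam (Suc n)))\<^sup>2"
        unfolding norm_dirichlet_term exp_diff exp_double by simp
      also have "\<dots> \<le> B / (\<kappa> * real n)\<^sup>2"
        using B L n by (intro frac_le power_mono) auto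
      finally show ?thesis by (simp add: power_mult_distrib divide_inverse)
    qed
    then show "\<forall>\<^sub>F n in sequentially. norm (norm (a (Suc n)) * exp (- lam (Suc n) * x)) \<le> B / \<kappa>\<^sup>2 * inverse (real n ^ 2)"
      by (auto simp: eventually_at_top_linorder intro!: exI[of _ 1])
  qed
  then show ?thesis using that by blast
qed

text \<open>On a vertical line the norm of each term is constant, so the Weierstrass test
  applies.\<close>

lemma uniform_limit_dirichlet:
  assumes "summable (\<lambda>n. norm (a (Suc n)) * exp (- lam (Suc n) * x))"
  shows "uniform_limit {w. Re w = x} (\<lambda>P w. \<Sum>n=1..P. dirichlet_term lam a w n) (dirichlet_limit lam a) sequentially"
proof -
  have "uniform_limit {w. Re w = x} (\<lambda>P w. \<Sum>i<P. dirichlet_term lam a w (Suc i))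
     (\<lambda>w. \<Sum>i. dirichlet_term lam a w (Suc i)) sequentially"
    by (rule Weierstrass_m_test[OF _ assms]) (auto simp: norm_dirichlet_term)
  moreover have "(\<Sum>i<P. dirichlet_term lam a w (Suc i)) = (\<Sum>n=1..P. dirichlet_term lam a w n)" for P w
    by (rule sum.reindex_bij_witness[of _ "\<lambda>n. n - 1" Suc]) auto
  ultimately show ?thesis
    by (simp add: dirichlet_limit_def[abs_def])
qed

section \<open>Perron integrals for partial sums of Dirichlet series\<close>

lemma dirichlet_term_add:
  "dirichlet_term lam a (s + z) n = dirichlet_term lam a s n * exp (- of_real (lam n) * z)"
  using exp_add[of "- of_real (lam n) * s" "- of_real (lam n) * z"]
  by (simp add: dirichlet_term_def distrib_left)

text \<open>No frequency lies strictly between \<open>a\<close> and \<open>b\<close>, so the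
  trapezoid takes only the values 1 and 0 and cuts the polynomial exactly after \<open>N\<close>.
  The coefficients are called \<alpha> here because \<open>a\<close> and \<open>b\<close> are the
  kernel parameters.\<close>

lemma dirichlet_polynomial_perron:
  assumes c: "0 < c" and ab: "a < b" and NP: "N \<le> P"
    and le: "\<And>n. 1 \<le> n \<Longrightarrow> n \<le> N \<Longrightarrow> lam n \<le> a" and ge: "\<And>n. n > N \<Longrightarrow> b \<le> lam n"
  shows "((\<lambda>T. vertical_integral (\<lambda>z. (\<Sum>n=1..P. dirichlet_term lam \<alpha> (s + z) n) * riesz_kernel a b z) c T)
    \<longlongrightarrow> 2 * pi * \<i> * (\<Sum>n=1..N. dirichlet_term lam \<alpha> s n)) at_top"
proof -
  define h where "h n z = exp (- of_real (lam n) * z) * riesz_kernel a b z" for n z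
  have "continuous_on {z. Re z = c} (riesz_kernel a b)"
    by (rule continuous_on_subset[OF holomorphic_on_imp_continuous_on[OF riesz_kernel_holomorphic]])
       (use c in auto)
  then have cont: "continuous_on {z. Re z = c} (h n)" for n
    unfolding h_def by (intro continuous_intros)
  have eq: "(\<lambda>z. (\<Sum>n=1..P. dirichlet_term lam \<alpha> (s + z) n) * riesz_kernel a b z)
     = (\<lambda>z. \<Sum>n=1..P. dirichlet_term lam \<alpha> s n * h n z)"
    by (intro ext) (simp only: dirichlet_term_add h_def sum_distrib_right mult.assoc)
  have V: "vertical_integral (\<lambda>z. (\<Sum>n=1..P. dirichlet_term lam \<alpha> (s + z) n) * riesz_kernel a b z) c T
     = (\<Sum>n=1..P. dirichlet_term lam \<alpha> s n * vertical_integral (h n) c T)" for T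
    unfolding eq
    by (subst vertical_integral_sum)
       (auto intro!: continuous_intros cont sum.cong simp: vertical_integral_cmult[OF cont])
  have "((\<lambda>T. \<Sum>n=1..P. dirichlet_term lam \<alpha> s n * vertical_integral (h n) c T) \<longlongrightarrow>
     (\<Sum>n=1..P. dirichlet_term lam \<alpha> s n *
        (2 * pi * \<i> * complex_of_real ((max (b - lam n) 0 - max (a - lam n) 0) / (b - a))))) at_top"
    unfolding h_def by (intro tendsto_intros riesz_kernel_perron c ab)
  also have "(\<Sum>n=1..P. dirichlet_term lam \<alpha> s n *
        (2 * pi * \<i> * complex_of_real ((max (b - lam n) 0 - max (a - lam n) 0) / (b - a))))
     = (\<Sum>n=1..P. if n \<le> N then 2 * pi * \<i> * dirichlet_term lam \<alpha> s n else 0)"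
  proof (rule sum.cong)
    fix n assume n: "n \<in> {1..P}"
    have "(max (b - lam n) 0 - max (a - lam n) 0) / (b - a) = (if n \<le> N then 1 else 0)"
      using n le[of n] ge[of n] ab by auto
    then show "dirichlet_term lam \<alpha> s n * (2 * pi * \<i> * complex_of_real ((max (b - lam n) 0 - max (a - lam n) 0) / (b - a)))
      = (if n \<le> N then 2 * pi * \<i> * dirichlet_term lam \<alpha> s n else 0)"
      by simp
  qed auto
  also have "\<dots> = (\<Sum>n=1..N. 2 * pi * \<i> * dirichlet_term lam \<alpha> s n)"
    using NP by (intro sum.mono_neutral_cong_right) auto
  also have "\<dots> = 2 * pi * \<i> * (\<Sum>n=1..N. dirichlet_term lam \<alpha> s n)"
    by (simp add: sum_distrib_left)
  finally show ?thesis unfolding V .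
qed

text \<open>On the line, \<open>f\<close> is uniformly approximated by a long partial sum. The
  kernel bound controls the error uniformly in \<open>T\<close>, so one fixed length
  \<open>P\<close> suffices for all \<open>T\<close>.\<close>

lemma partial_sum_perron_far:
  assumes X: "0 < X" and ab: "0 \<le> a" "a < b"
    and le: "\<And>n. 1 \<le> n \<Longrightarrow> n \<le> N \<Longrightarrow> lam n \<le> a" and ge: "\<And>n. n > N \<Longrightarrow> b \<le> lam n"
    and cont: "continuous_on {z. Re z = X} (\<lambda>z. f (s + z))"
    and f: "\<And>w. Re w = Re s + X \<Longrightarrow> f w = dirichlet_limit lam \<alpha> w"
    and summ: "summable (\<lambda>n. norm (\<alpha> (Suc n)) * exp (- lam (Suc n) * (Re s + X)))"
  shows "((\<lambda>T. vertical_integral (\<lambda>z. f (s + z) * riesz_kernel a b z) X T)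
    \<longlongrightarrow> 2 * pi * \<i> * (\<Sum>n=1..N. dirichlet_term lam \<alpha> s n)) at_top"
proof (rule tendstoI)
  fix \<epsilon> :: real assume \<epsilon>: "\<epsilon> > 0"
  define B where "B = 8 * exp (b * X) * ln (1 + 4 / ((b - a) * X))"
  have B: "B \<ge> 0" using X ab by (simp add: B_def)
  \<comment> \<open>The denominator uses \<open>B + 1\<close> to stay positive and to make
    \<open>\<eta> * B\<close> strictly smaller than half of \<epsilon>.\<close>
  define \<eta> where "\<eta> = \<epsilon> / (2 * (B + 1))"
  have \<eta>: "\<eta> > 0" "\<eta> * B < \<epsilon> / 2"
    using \<epsilon> B by (auto simp: \<eta>_def field_simps)
  let ?S = "\<lambda>P w. \<Sum>n=1..P. dirichlet_term lam \<alpha> w n"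
  have "\<forall>\<^sub>F P in sequentially. P \<ge> N \<and> (\<forall>w\<in>{w. Re w = Re s + X}. dist (?S P w) (dirichlet_limit lam \<alpha> w) < \<eta>)"
    by (intro eventually_conj eventually_ge_at_top uniform_limitD[OF uniform_limit_dirichlet[OF summ] \<eta>(1)])
  then obtain P where P: "P \<ge> N" "\<And>w. Re w = Re s + X \<Longrightarrow> dist (?S P w) (dirichlet_limit lam \<alpha> w) < \<eta>"
    by (auto simp: eventually_at_top_linorder)
  let ?K = "riesz_kernel a b"
  let ?R = "\<lambda>z. f (s + z) - ?S P (s + z)"
  have contK: "continuous_on {z. Re z = X} ?K"
    by (rule continuous_on_subset[OF holomorphic_on_imp_continuous_on[OF riesz_kernel_holomorphic]])
       (use X in auto)
  have contS: "continuous_on {z. Re z = X} (\<lambda>z. ?S P (s + z))"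
    unfolding dirichlet_term_def by (intro continuous_intros)
  have split: "vertical_integral (\<lambda>z. f (s + z) * ?K z) X T
     = vertical_integral (\<lambda>z. ?S P (s + z) * ?K z) X T + vertical_integral (\<lambda>z. ?R z * ?K z) X T" for T
  proof -
    have "(\<lambda>z. f (s + z) * ?K z) = (\<lambda>z. ?S P (s + z) * ?K z + ?R z * ?K z)"
      by (simp add: left_diff_distrib)
    then show ?thesis
      by (simp only: vertical_integral_add[OF continuous_on_mult[OF contS contK]
            continuous_on_mult[OF continuous_on_diff[OF cont contS] contK]])
  qed
  have rest: "norm (vertical_integral (\<lambda>z. ?R z * ?K z) X T) < \<epsilon> / 2" if "T > 0" for T
  proof -
    have "norm (vertical_integral (\<lambda>z. ?R z * ?K z) X T) \<le> 8 * \<eta> * exp (b * X) * ln (1 + 4 / ((b - a) * X))"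
    proof (rule vertical_integral_riesz_kernel_bound[OF ab X that])
      show "continuous_on {z. Re z = X} ?R"
        by (intro continuous_intros cont contS)
      show "norm (?R z) \<le> \<eta>" if "Re z = X" for z
        using P(2)[of "s + z"] f[of "s + z"] that by (simp add: dist_norm norm_minus_commute less_imp_le)
    qed
    also have "\<dots> = \<eta> * B" by (simp add: B_def)
    finally show ?thesis using \<eta> by simp
  qed
  let ?L = "2 * pi * \<i> * (\<Sum>n=1..N. dirichlet_term lam \<alpha> s n)"
  have "((\<lambda>T. vertical_integral (\<lambda>z. ?S P (s + z) * ?K z) X T) \<longlongrightarrow> ?L) at_top"
    by (rule dirichlet_polynomial_perron) (use X ab P le ge in auto)
  then have "\<forall>\<^sub>F T in at_top. dist (vertical_integral (\<lambda>z. ?S P (s + z) * ?K z) X T) ?L < \<epsilon> / 2"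
    using \<epsilon> by (intro tendstoD) auto
  then show "\<forall>\<^sub>F T in at_top. dist (vertical_integral (\<lambda>z. f (s + z) * ?K z) X T) ?L < \<epsilon>"
    using eventually_gt_at_top[of 0]
  proof eventually_elim
    case (elim T)
    have "norm ((vertical_integral (\<lambda>z. ?S P (s + z) * ?K z) X T - ?L) + vertical_integral (\<lambda>z. ?R z * ?K z) X T)
        < \<epsilon> / 2 + \<epsilon> / 2"
      using elim(1) rest[OF elim(2)] unfolding dist_norm by (rule norm_add_less)
    then show ?case
      unfolding split dist_norm by (simp add: algebra_simps)
  qed
qed

text \<open>The product is holomorphic on \<open>Re z > 0\<close>, so the rectangle integral
  vanishes by Cauchy's theorem. The horizontal sides have fixed length and integrands of size
  \<open>O(1 / T\<^sup>2)\<close>.\<close>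

lemma vertical_integral_riesz_kernel_shift:
  assumes cX: "0 < c" "c \<le> X" and ab: "0 \<le> a" "a < b"
    and holo: "g holomorphic_on {z. Re z > 0}"
    and M: "\<And>z. Re z > 0 \<Longrightarrow> norm (g z) \<le> M"
  shows "((\<lambda>T. vertical_integral (\<lambda>z. g z * riesz_kernel a b z) X T
             - vertical_integral (\<lambda>z. g z * riesz_kernel a b z) c T) \<longlongrightarrow> 0) at_top"
proof -
  let ?h = "\<lambda>z. g z * riesz_kernel a b z"
  define A where "A = M * (2 * exp (b * X) / (b - a))"
  have M0: "0 \<le> M" using M[of 1] norm_ge_zero[of "g 1"] by (simp del: norm_ge_zero)
  have holoh: "?h holomorphic_on {z. Re z > 0}"
    by (intro holomorphic_intros holo riesz_kernel_holomorphic)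
  have "norm (vertical_integral ?h X T - vertical_integral ?h c T) \<le> 2 * A * (X - c) / T\<^sup>2" if T: "T > 0" for T
  proof -
    have sub: "path_image (rectpath (Complex c (-T)) (Complex X T)) \<subseteq> {z. Re z > 0}"
      using cX T by (subst path_image_rectpath) auto
    have "norm (vertical_integral ?h X T - vertical_integral ?h c T
            - contour_integral (rectpath (Complex c (-T)) (Complex X T)) ?h) \<le> 2 * (A / T\<^sup>2) * (X - c)"
    proof (rule vertical_integral_shift)
      show "continuous_on (path_image (rectpath (Complex c (- T)) (Complex X T))) ?h"
        using holomorphic_on_imp_continuous_on[OF holoh] sub by (rule continuous_on_subset)
      fix x y assume xy: "c \<le> x" "x \<le> X" "\<bar>y\<bar> = T"
      have "norm (riesz_kernel a b (Complex x y)) \<le> 2 * exp (b * x) / ((b - a) * (norm (Complex x y))\<^sup>2)"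
        using norm_riesz_kernel_le_inverse_square[of a b "Complex x y"] ab xy cX by simp
      also have "\<dots> \<le> 2 * exp (b * X) / ((b - a) * T\<^sup>2)"
      proof (intro frac_le mult_left_mono power_mono)
        show "exp (b * x) \<le> exp (b * X)"
          using xy ab by simp
        show "T \<le> norm (Complex x y)"
          using xy abs_Im_le_cmod[of "Complex x y"] by simp
      qed (use ab T in auto)
      finally have "norm (?h (Complex x y)) \<le> M * (2 * exp (b * X) / ((b - a) * T\<^sup>2))"
        unfolding norm_mult using xy cX M0 by (intro mult_mono M) auto
      also have "\<dots> = A / T\<^sup>2"
        by (simp add: A_def)
      finally show "norm (?h (Complex x y)) \<le> A / T\<^sup>2" .
    qed (use cX T in auto)
    moreover have "contour_integral (rectpath (Complex c (-T)) (Complex X T)) ?h = 0"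
      by (intro contour_integral_unique Cauchy_theorem_convex_simple[OF holoh] convex_halfspace_Re_gt sub) auto
    ultimately show ?thesis by simp
  qed
  moreover have "((\<lambda>T::real. 2 * A * (X - c) / T\<^sup>2) \<longlongrightarrow> 0) at_top"
    by (intro tendsto_divide_0[OF tendsto_const] filterlim_at_top_imp_at_infinity filterlim_pow_at_top filterlim_ident) auto
  ultimately show ?thesis
    by (rule Lim_null_comparison[OF eventually_mono[OF eventually_gt_at_top[of 0]]])
qed

text \<open>The far line identifies the partial sum, and the line \<open>Re z = 1 / b\<close> bounds
  it. There \<open>exp (b * c)\<close> is \<open>exp 1\<close>, and the logarithm depends only on
  \<open>b / (b - a)\<close>.\<close>

lemma partial_sum_bound:
  assumes freq: "frequency lam" and bohr: "bohr_condition lam"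
    and ext: "bounded_extension lam \<alpha> f"
    and M: "\<And>w. Re w > 0 \<Longrightarrow> norm (f w) \<le> M"
    and s: "Re s > 0" and ab: "0 \<le> a" "a < b"
    and le: "\<And>n. 1 \<le> n \<Longrightarrow> n \<le> N \<Longrightarrow> lam n \<le> a" and ge: "\<And>n. n > N \<Longrightarrow> b \<le> lam n"
  shows "norm (\<Sum>n=1..N. dirichlet_term lam \<alpha> s n) \<le> 8 * exp 1 * M * ln (1 + 4 * b / (b - a))"
proof -
  let ?V = "vertical_integral (\<lambda>z. f (s + z) * riesz_kernel a b z)"
  let ?L = "2 * pi * \<i> * (\<Sum>n=1..N. dirichlet_term lam \<alpha> s n)"
  have b: "b > 0" using ab by simp
  obtain \<sigma> where \<sigma>: "\<sigma> \<ge> 0" "\<And>w. Re w > \<sigma> \<Longrightarrow> dirichlet_converges lam \<alpha> w"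
    "\<And>w. Re w > \<sigma> \<Longrightarrow> f w = dirichlet_limit lam \<alpha> w"
    using ext unfolding bounded_extension_def right_half_plane_def by auto
  have conv: "dirichlet_converges lam \<alpha> (of_real (\<sigma> + 1))"
    by (rule \<sigma>(2)) simp
  obtain \<tau> where \<tau>: "\<And>x. x \<ge> \<tau> \<Longrightarrow> summable (\<lambda>n. norm (\<alpha> (Suc n)) * exp (- lam (Suc n) * x))"
    by (rule absolute_convergence_far[OF freq bohr conv]) (rule that)
  \<comment> \<open>Large enough to lie right of \<open>1 / b\<close> and to put
    \<open>s + z\<close> where \<open>f\<close> equals the series and the series converges
    absolutely.\<close>
  define X where "X = \<bar>\<tau>\<bar> + \<sigma> + 1 + 1 / b"
  have X: "X > 0" "1 / b \<le> X" "Re s + X > \<sigma>" "Re s + X \<ge> \<tau>"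
  proof -
    have "0 < 1 / b" using b by simp
    then show "X > 0" "1 / b \<le> X" "Re s + X > \<sigma>" "Re s + X \<ge> \<tau>"
      using \<sigma>(1) s unfolding X_def by linarith+
  qed
  have holo: "(\<lambda>z. f (s + z)) holomorphic_on {z. Re z > 0}"
    by (rule holomorphic_on_compose_gen[of "\<lambda>z. s + z" _ f "{z. Re z > 0}", unfolded o_def])
       (use ext s in \<open>auto intro!: holomorphic_intros simp: bounded_extension_def right_half_plane_def\<close>)
  have cont: "continuous_on {z. Re z = x} (\<lambda>z. f (s + z))" if "x > 0" for x
    by (rule continuous_on_subset[OF holomorphic_on_imp_continuous_on[OF holo]]) (use that in auto)
  have far: "(?V X \<longlongrightarrow> ?L) at_top"
    by (rule partial_sum_perron_far) (use X ab le ge cont \<sigma> \<tau> in auto)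
  have "((\<lambda>T. ?V X T - ?V (1 / b) T) \<longlongrightarrow> 0) at_top"
    by (rule vertical_integral_riesz_kernel_shift[OF _ X(2) ab holo, of M]) (use b M s in auto)
  from tendsto_diff[OF far this] have lim: "(?V (1 / b) \<longlongrightarrow> ?L) at_top"
    by simp
  have bound: "norm (?V (1 / b) T) \<le> 8 * M * exp (b * (1 / b)) * ln (1 + 4 / ((b - a) * (1 / b)))" if "T > 0" for T
    by (rule vertical_integral_riesz_kernel_bound[OF ab]) (use that b s cont in \<open>auto intro!: M add_pos_pos\<close>)
  have "norm ?L \<le> 8 * M * exp (b * (1 / b)) * ln (1 + 4 / ((b - a) * (1 / b)))"
    by (rule tendsto_upperbound[OF tendsto_norm[OF lim] eventually_mono[OF eventually_gt_at_top[of 0] bound]])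
       simp_all
  also have "\<dots> = 8 * exp 1 * M * ln (1 + 4 * b / (b - a))"
    using b by simp
  finally have "2 * pi * norm (\<Sum>n=1..N. dirichlet_term lam \<alpha> s n) \<le> 8 * exp 1 * M * ln (1 + 4 * b / (b - a))"
    by (simp add: norm_mult)
  moreover have "1 * norm (\<Sum>n=1..N. dirichlet_term lam \<alpha> s n) \<le> 2 * pi * norm (\<Sum>n=1..N. dirichlet_term lam \<alpha> s n)"
    using pi_ge_two by (intro mult_right_mono) auto
  ultimately show ?thesis by linarith
qed

section \<open>Monotonicity of frequencies and logarithms of their gaps\<close>

lemma frequency_le:
  assumes "frequency lam" "1 \<le> m" "m \<le> n"
  shows "lam m \<le> lam n"
  using assms strict_mono_on_leD[of "{1..}" lam m n] by (auto simp: frequency_def)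

lemma frequency_less:
  assumes "frequency lam" "1 \<le> m" "m < n"
  shows "lam m < lam n"
  using assms by (auto simp: frequency_def strict_mono_on_def)

text \<open>The logarithm equals \<open>ln (5 * d + 4 * lam N) - ln d\<close>. The first part is at
  most linear in \<open>lam N\<close> because \<open>d \<le> 1\<close>; Bohr's condition makes
  \<open>- ln d\<close> at most linear too.\<close>

lemma bohr_condition_log_gap:
  assumes freq: "frequency lam" and bohr: "bohr_condition lam"
  obtains K where "K > 0"
    "\<And>N d. N \<ge> 2 \<Longrightarrow> d = min 1 (lam (N + 1) - lam N) \<Longrightarrow> ln (1 + 4 * (lam N + d) / d) \<le> K * lam N"
proof -
  obtain l where l: "l > 0" "\<forall>\<delta>>0. \<exists>C>0. \<forall>n\<ge>1. lam (n + 1) - lam n \<ge> C * exp (- (l + \<delta>) * lam n)"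
    using bohr unfolding bohr_condition_def by blast
  then obtain C where C: "C > 0" "\<And>n. n \<ge> 1 \<Longrightarrow> lam (n + 1) - lam n \<ge> C * exp (- (l + 1) * lam n)"
    by (meson zero_less_one)
  \<comment> \<open>This is where \<open>N \<ge> 2\<close> enters: \<open>lam 1\<close> may be 0,
    whereas additive constants can be absorbed into a multiple of \<open>lam N\<close> once
    \<open>lam N \<ge> lam 2 > 0\<close>.\<close>
  have lam2: "lam 2 > 0"
    using frequency_less[OF freq, of 1 2] freq by (auto simp: frequency_def intro: order_le_less_trans)
  define K where "K = (4 + \<bar>ln C\<bar>) / lam 2 + (5 + l)"
  have "ln (1 + 4 * (lam N + d) / d) \<le> K * lam N"
    if N: "N \<ge> 2" and d_def: "d = min 1 (lam (N + 1) - lam N)" for N d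
  proof -
    have a: "lam N \<ge> lam 2"
      using N by (intro frequency_le[OF freq]) auto
    have d: "0 < d" "d \<le> 1"
      using frequency_less[OF freq, of N "N + 1"] N by (auto simp: d_def)
    have "ln (C * exp (- (l + 1) * lam N)) \<le> ln (lam (N + 1) - lam N)"
      using C(1) C(2)[of N] N by (intro ln_mono) auto
    then have "ln C - (l + 1) * lam N \<le> ln (lam (N + 1) - lam N)"
      using C(1) by (simp add: ln_mult algebra_simps)
    moreover have "0 \<le> (l + 1) * lam N"
      using l a lam2 by simp
    \<comment> \<open>If the minimum is 1, then \<open>ln d = 0\<close> and the left side is
      nonpositive; otherwise the gap estimate applies.\<close>
    ultimately have lnd: "- \<bar>ln C\<bar> - (l + 1) * lam N \<le> ln d"
      unfolding d_def min_def by auto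
    have "1 + 4 * (lam N + d) / d = (5 * d + 4 * lam N) / d"
      using d by (simp add: field_simps)
    then have "ln (1 + 4 * (lam N + d) / d) = ln (5 * d + 4 * lam N) - ln d"
      using ln_div[of "5 * d + 4 * lam N" d] d a lam2 by simp
    also have "ln (5 * d + 4 * lam N) \<le> (5 * d + 4 * lam N) - 1"
      using d a lam2 by (intro ln_le_minus_one add_pos_pos) auto
    also have "(5 * d + 4 * lam N) - 1 - ln d \<le> (4 + \<bar>ln C\<bar>) + (5 + l) * lam N"
      using d lnd by (simp add: algebra_simps)
    also have "4 + \<bar>ln C\<bar> \<le> (4 + \<bar>ln C\<bar>) / lam 2 * lam N"
      using a lam2 by (simp add: pos_le_divide_eq mult_left_mono)
    finally show ?thesis
      by (simp add: K_def algebra_simps)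
  qed
  moreover have "K > 0"
    unfolding K_def using l lam2 by (intro add_nonneg_pos) auto
  ultimately show ?thesis using that by blast
qed

theorem theorem4p4:
  fixes lam :: "nat \<Rightarrow> real"
  assumes "frequency lam"
    and "bohr_condition lam"
  shows "\<exists>C>0. \<forall>a\<in>D_infty_ext lam. \<forall>N\<ge>2.
           (SUP s\<in>right_half_plane 0. norm (\<Sum>n=1..N. dirichlet_term lam a s n))
             \<le> C * lam N * D_norm lam a"
proof -
  obtain K where K: "K > 0"
    "\<And>N d. N \<ge> 2 \<Longrightarrow> d = min 1 (lam (N + 1) - lam N) \<Longrightarrow> ln (1 + 4 * (lam N + d) / d) \<le> K * lam N"
    using bohr_condition_log_gap[OF assms] by blast
  have "(SUP s\<in>right_half_plane 0. norm (\<Sum>n=1..N. dirichlet_term lam a s n))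
      \<le> 8 * exp 1 * K * lam N * D_norm lam a"
    if a: "a \<in> D_infty_ext lam" and N: "N \<ge> 2" for a N
  proof (rule cSUP_least)
    show "right_half_plane 0 \<noteq> {}"
      by (auto simp: right_half_plane_def intro!: exI[of _ 1])
    fix s assume s: "s \<in> right_half_plane 0"
    \<comment> \<open>The kernel ramp runs from \<open>lam N\<close> to \<open>lam N + d\<close>; it
      ends no later than the next frequency, and its length is capped at 1 as the logarithmic
      estimate requires.\<close>
    define d where "d = min 1 (lam (N + 1) - lam N)"
    have d: "d > 0" "lam N + d \<le> lam (N + 1)"
      using frequency_less[OF assms(1), of N "N + 1"] N by (auto simp: d_def)
    have ext: "bounded_extension lam a (the_extension lam a)"
      using a someI_ex[of "bounded_extension lam a"] by (auto simp: D_infty_ext_def the_extension_def)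
    have M: "norm (the_extension lam a w) \<le> D_norm lam a" if "Re w > 0" for w
      unfolding D_norm_def using that
      by (intro cSUP_upper bdd_above_extension[OF a]) (auto simp: right_half_plane_def)
    have D0: "0 \<le> D_norm lam a"
      using M[of 1] norm_ge_zero[of "the_extension lam a 1"] by (simp del: norm_ge_zero)
    have "norm (\<Sum>n=1..N. dirichlet_term lam a s n)
        \<le> 8 * exp 1 * D_norm lam a * ln (1 + 4 * (lam N + d) / (lam N + d - lam N))"
    proof (rule partial_sum_bound[OF assms ext M])
      show "0 \<le> lam N" using assms(1) N by (auto simp: frequency_def)
      show "lam N + d \<le> lam n" if "n > N" for n
        using frequency_le[OF assms(1), of "N + 1" n] that d by auto
    qed (use s d N frequency_le[OF assms(1)] in \<open>auto simp: right_half_plane_def\<close>)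
    also have "\<dots> \<le> 8 * exp 1 * D_norm lam a * (K * lam N)"
      using K(2)[OF N d_def] D0 by (intro mult_left_mono) auto
    finally show "norm (\<Sum>n=1..N. dirichlet_term lam a s n) \<le> 8 * exp 1 * K * lam N * D_norm lam a"
      by (simp add: mult_ac)
  qed
  then show ?thesis
    using K(1) by (intro exI[of _ "8 * exp 1 * K"]) auto
qed

end
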